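(* Let $\mathcal{P}$ be a well-formed integer program with program variables $\vec x$, let $\alpha\in\mathcal{P}$ be a simple loop with $\mathrm{update}(\alpha)=\mu$ and $\mathrm{cost}(\alpha)=c$, let $\mathit{tv}$ be a fresh temporary variable, and let $\chi_\psi\cdot b$ be a metering function for $\alpha$, where $b$ is an arithmetic expression. Let $\mu_{\mathrm{it}}$ be a substitution and $c_{\mathrm{it}}$ an arithmetic expression such that, for all $\mathit{tv}>0$, $x\mu_{\mathrm{it}} = x\mu^{\mathit{tv}}$ is valid for all $x\in\vec x$ and $c_{\mathrm{it}}\leq\sum_{i=0}^{\mathit{tv}-1}c\mu^i$ is valid. Let $\mathcal{P}' = \mathcal{P}\cup\{\alpha_{\mathrm{it}}\}$, where $\alpha_{\mathrm{it}}$ is the rule \[ \mathrm{lhs}(\alpha)\xrightarrow{c_{\mathrm{it}}}\mathrm{lhs}(\alpha)\,\mu_{\mathrm{it}}\ [\mathrm{guard}(\alpha)\land\psi\land 0<\mathit{tv}<b+1]. \] Then $\mathcal{P}'$ is well formed and the processor mapping $\mathcal{P}$ to $\mathcal{P}'$ is sound.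
   Context: Fix a finite set $\Sigma$ of function symbols of common arity $k$ containing a start symbol $f_0$, and variables ranging over $\mathbb{Z}$. Arithmetic expressions are built from variables, numbers and operations such as $+,-,\cdot$, division, exponentiation; a constraint is a finite conjunction of inequations ($<,\leq,>,\geq$) between arithmetic expressions. A rule has the form $f(\vec x)\xrightarrow{c}T\ [\varphi]$ where $\vec x=(x_1,\dots,x_k)$ is a fixed vector of pairwise different program variables (the same for all rules), $f\in\Sigma$, $c$ is an arithmetic expression (cost), $T$ a finite multiset of terms $g(t_1,\dots,t_k)$ ($g\in\Sigma$, $t_i$ arithmetic expressions), and $\varphi$ a constraint (guard); notation $\mathrm{lhs},\mathrm{rhs},\mathrm{cost},\mathrm{guard}$; variables of a rule not in $\vec x$ are temporary variables. An integer program is a finite set of rules in which $f_0$ does not occur on right-hand sides. Substitutions map variables to arithmetic expressions, applied homomorphically ($t\sigma$), with $t(\theta\circ\sigma)=t\theta\sigma$ and $\mu^i$ the $i$-fold composition. An integer substitution maps variables of its domain to integers; $\sigma\models\varphi$ means $\mathcal{V}(\varphi)\subseteq\mathrm{dom}(\sigma)$ and $\sigma$ models $\varphi$; $\sigma\models\alpha$ means $\mathcal{V}(\alpha)\subseteq\mathrm{dom}(\sigma)$ and $\sigma\models\mathrm{guard}(\alpha)$. A formula is valid if every integer substitution whose domain contains its variables models it. A configuration is a finite multiset of terms $f(n_1,\dots,n_k)$, $n_i\in\mathbb{Z}$. $S\xrightarrow{k}_{\mathcal{P}}T$ if there are $s\in S$, a rule $f(\vec x)\xrightarrow{c}Q\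 [\varphi]$ in $\mathcal{P}$ and an integer substitution $\sigma$ covering the rule's variables with $f(\vec x)\sigma=s$, $\sigma\models\varphi$, $c\sigma=k$, $T=(S\setminus\{s\})\cup Q\sigma$ (multisets; equality modulo arithmetic); costs of sequences of steps are summed. $\mathrm{dh}_{\mathcal{P}}(S)=\sup\{k\mid S\xrightarrow{k}{}^{*}_{\mathcal{P}}T\}$ and $\mathrm{rc}_{\mathcal{P}}(n)=\sup\{\mathrm{dh}_{\mathcal{P}}(f_0(\vec n))\mid\vec n\in\mathbb{Z}^k,\sum_i|n_i|\leq n\}\in\mathbb{R}_{\geq0}\cup\{\omega\}$. A rule $\alpha$ is well formed if $t_i\sigma\in\mathbb{Z}$ for all $f(t_1,\dots,t_k)\in\mathrm{rhs}(\alpha)$, all $i$ and all integer substitutions $\sigma\models\alpha$; a program is well formed if all its rules are. A processor is a partial function on integer programs; it is sound if $\mathrm{rc}_{\mathcal{P}}(n)\geq\mathrm{rc}_{\mathrm{proc}(\mathcal{P})}(n)$ for all $n\in\mathbb{N}$ and all $\mathcal{P}$ where it is defined. A simple loop is a rule $f(\vec x)\xrightarrow{c}f(\vec x)\mu\ [\varphi]$ with $\mathrm{dom}(\mu)\subseteq\vec x$, $\mathrm{update}=\mu$. For a constraint $\psi$, $\chi_\psi\sigma=1$ if $\sigma\models\psi$ and $0$ otherwise. An expression $b$ is a metering function for a simple loop $\alpha$ with update $\mu$ if $\neg\mathrm{guard}(\alpha)\implies b\leq0$ and $\mathrm{guard}(\alpha)\implies b\mu\geq b-1$ are valid. *)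

theory Defs
  imports Complex_Main "HOL-Library.Multiset" "HOL-Library.Extended_Real"
begin

section \<open>Arithmetic expressions, constraints and substitutions\<close>

datatype 'v aexp =
    Var 'v
  | Const real
  | Add "'v aexp" "'v aexp"
  | Sub "'v aexp" "'v aexp"
  | Mul "'v aexp" "'v aexp"
  | Div "'v aexp" "'v aexp"
  | Pow "'v aexp" "'v aexp"

text \<open>The library operator \<open>powr\<close> is only meaningful for positive bases, so integral exponents
  (for which e.g. \<open>(-2) ^ n\<close> and \<open>0 ^ 0 = 1\<close> have to come out right) are handled by \<open>powi\<close>.\<close>

definition real_pow :: "real \<Rightarrow> real \<Rightarrow> real" where
  "real_pow x y = (if y \<in> \<int> then x powi \<lfloor>y\<rfloor> else x powr y)"

text \<open>Expressions denote real numbers; division is the total division of the library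
  (\<open>x / 0 = 0\<close>).\<close>

primrec aeval :: "('v \<Rightarrow> real) \<Rightarrow> 'v aexp \<Rightarrow> real" where
  "aeval v (Var x) = v x"
| "aeval v (Const r) = r"
| "aeval v (Add s t) = aeval v s + aeval v t"
| "aeval v (Sub s t) = aeval v s - aeval v t"
| "aeval v (Mul s t) = aeval v s * aeval v t"
| "aeval v (Div s t) = aeval v s / aeval v t"
| "aeval v (Pow s t) = real_pow (aeval v s) (aeval v t)"

abbreviation avars :: "'v aexp \<Rightarrow> 'v set" where
  "avars \<equiv> set_aexp"

type_synonym 'v subst = "'v \<Rightarrow> 'v aexp"

definition subst_dom :: "'v subst \<Rightarrow> 'v set" where
  "subst_dom \<sigma> = {x. \<sigma> x \<noteq> Var x}"

primrec asubst :: "'v subst \<Rightarrow> 'v aexp \<Rightarrow> 'v aexp" where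
  "asubst \<sigma> (Var x) = \<sigma> x"
| "asubst \<sigma> (Const r) = Const r"
| "asubst \<sigma> (Add s t) = Add (asubst \<sigma> s) (asubst \<sigma> t)"
| "asubst \<sigma> (Sub s t) = Sub (asubst \<sigma> s) (asubst \<sigma> t)"
| "asubst \<sigma> (Mul s t) = Mul (asubst \<sigma> s) (asubst \<sigma> t)"
| "asubst \<sigma> (Div s t) = Div (asubst \<sigma> s) (asubst \<sigma> t)"
| "asubst \<sigma> (Pow s t) = Pow (asubst \<sigma> s) (asubst \<sigma> t)"

text \<open>Composition in diagrammatic order: \<open>t (\<theta> \<circ> \<sigma>) = (t \<theta>) \<sigma>\<close>.\<close>

definition subst_comp :: "'v subst \<Rightarrow> 'v subst \<Rightarrow> 'v subst" where
  "subst_comp \<theta> \<sigma> = (\<lambda>x. asubst \<sigma> (\<theta> x))"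

primrec subst_pow :: "'v subst \<Rightarrow> nat \<Rightarrow> 'v subst" where
  "subst_pow \<mu> 0 = Var"
| "subst_pow \<mu> (Suc i) = subst_comp (subst_pow \<mu> i) \<mu>"

datatype 'v ineq =
    Less "'v aexp" "'v aexp"
  | Leq "'v aexp" "'v aexp"
  | Greater "'v aexp" "'v aexp"
  | Geq "'v aexp" "'v aexp"

text \<open>A list of inequations stands for their conjunction.\<close>

type_synonym 'v constr = "'v ineq list"

definition cvars :: "'v constr \<Rightarrow> 'v set" where
  "cvars \<phi> = (\<Union>i\<in>set \<phi>. set_ineq i)"

primrec isubst :: "'v subst \<Rightarrow> 'v ineq \<Rightarrow> 'v ineq" where
  "isubst \<sigma> (Less s t) = Less (asubst \<sigma> s) (asubst \<sigma> t)"
| "isubst \<sigma> (Leq s t) = Leq (asubst \<sigma> s) (asubst \<sigma> t)"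
| "isubst \<sigma> (Greater s t) = Greater (asubst \<sigma> s) (asubst \<sigma> t)"
| "isubst \<sigma> (Geq s t) = Geq (asubst \<sigma> s) (asubst \<sigma> t)"

definition csubst :: "'v subst \<Rightarrow> 'v constr \<Rightarrow> 'v constr" where
  "csubst \<sigma> \<phi> = map (isubst \<sigma>) \<phi>"


section \<open>Integer substitutions and validity\<close>

type_synonym 'v int_subst = "'v \<rightharpoonup> int"

text \<open>The value of \<open>t \<sigma>\<close>; meaningful only if \<open>avars t \<subseteq> dom \<sigma>\<close>, which is required wherever
  it is used.\<close>

definition ival :: "'v int_subst \<Rightarrow> 'v aexp \<Rightarrow> real" where
  "ival \<sigma> t = aeval (\<lambda>x. real_of_int (the (\<sigma> x))) t"

primrec holds :: "'v int_subst \<Rightarrow> 'v ineq \<Rightarrow> bool" where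
  "holds \<sigma> (Less s t) \<longleftrightarrow> ival \<sigma> s < ival \<sigma> t"
| "holds \<sigma> (Leq s t) \<longleftrightarrow> ival \<sigma> s \<le> ival \<sigma> t"
| "holds \<sigma> (Greater s t) \<longleftrightarrow> ival \<sigma> s > ival \<sigma> t"
| "holds \<sigma> (Geq s t) \<longleftrightarrow> ival \<sigma> s \<ge> ival \<sigma> t"

definition models :: "'v int_subst \<Rightarrow> 'v constr \<Rightarrow> bool" where
  "models \<sigma> \<phi> \<longleftrightarrow> cvars \<phi> \<subseteq> dom \<sigma> \<and> (\<forall>i\<in>set \<phi>. holds \<sigma> i)"

text \<open>Validity of a formula with variables \<open>V\<close> whose truth value under \<open>\<sigma>\<close> is \<open>F \<sigma>\<close>.\<close>

definition valid :: "'v set \<Rightarrow> ('v int_subst \<Rightarrow> bool) \<Rightarrow> bool" where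
  "valid V F \<longleftrightarrow> (\<forall>\<sigma>. V \<subseteq> dom \<sigma> \<longrightarrow> F \<sigma>)"


section \<open>Rules and integer programs\<close>

type_synonym ('f, 'v) fterm = "'f \<times> 'v aexp list"

definition tvars :: "('f, 'v) fterm \<Rightarrow> 'v set" where
  "tvars t = (\<Union>e\<in>set (snd t). avars e)"

definition tsubst :: "'v subst \<Rightarrow> ('f, 'v) fterm \<Rightarrow> ('f, 'v) fterm" where
  "tsubst \<sigma> t = (fst t, map (asubst \<sigma>) (snd t))"

datatype ('f, 'v) rule =
  Rule (lhs: "('f, 'v) fterm") (cost: "'v aexp") (rhs: "('f, 'v) fterm multiset")
    (guard: "'v constr")

definition rule_vars :: "('f, 'v) rule \<Rightarrow> 'v set" where
  "rule_vars \<alpha> = tvars (lhs \<alpha>) \<union> avars (cost \<alpha>) \<union> (\<Union>t\<in>set_mset (rhs \<alpha>). tvars t) \<union> cvars (guard \<alpha>)"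

definition models_rule :: "'v int_subst \<Rightarrow> ('f, 'v) rule \<Rightarrow> bool" where
  "models_rule \<sigma> \<alpha> \<longleftrightarrow> rule_vars \<alpha> \<subseteq> dom \<sigma> \<and> models \<sigma> (guard \<alpha>)"

type_synonym ('f, 'v) program = "('f, 'v) rule set"

text \<open>Signature \<open>F\<close>, start symbol \<open>f0\<close>, program variables \<open>xs\<close>; the common arity is
  \<open>length xs\<close>.\<close>

definition integer_program :: "'f set \<Rightarrow> 'f \<Rightarrow> 'v list \<Rightarrow> ('f, 'v) program \<Rightarrow> bool" where
  "integer_program F f0 xs P \<longleftrightarrow> finite P \<and>
     (\<forall>\<alpha>\<in>P. (\<exists>f\<in>F. lhs \<alpha> = (f, map Var xs)) \<and>
            (\<forall>(g, ts)\<in>set_mset (rhs \<alpha>). g \<in> F \<and> g \<noteq> f0 \<and> length ts = length xs))"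

definition well_formed_rule :: "('f, 'v) rule \<Rightarrow> bool" where
  "well_formed_rule \<alpha> \<longleftrightarrow>
     (\<forall>\<sigma>. models_rule \<sigma> \<alpha> \<longrightarrow> (\<forall>(f, ts)\<in>set_mset (rhs \<alpha>). \<forall>t\<in>set ts. ival \<sigma> t \<in> \<int>))"

definition well_formed :: "('f, 'v) program \<Rightarrow> bool" where
  "well_formed P \<longleftrightarrow> (\<forall>\<alpha>\<in>P. well_formed_rule \<alpha>)"


section \<open>Evaluation and runtime complexity\<close>

type_synonym 'f config = "('f \<times> int list) multiset"

text \<open>Equality of terms modulo arithmetic is equality of their values; both instances of terms
  and elements of configurations are compared as terms over the reals.\<close>

definition tval :: "'v int_subst \<Rightarrow> ('f, 'v) fterm \<Rightarrow> 'f \<times> real list" where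
  "tval \<sigma> t = (fst t, map (ival \<sigma>) (snd t))"

definition of_cterm :: "'f \<times> int list \<Rightarrow> 'f \<times> real list" where
  "of_cterm s = (fst s, map real_of_int (snd s))"

definition step :: "('f, 'v) program \<Rightarrow> 'f config \<Rightarrow> real \<Rightarrow> 'f config \<Rightarrow> bool" where
  "step P S k T \<longleftrightarrow>
     (\<exists>s \<alpha> \<sigma> Q. s \<in># S \<and> \<alpha> \<in> P \<and> rule_vars \<alpha> \<subseteq> dom \<sigma> \<and>
        tval \<sigma> (lhs \<alpha>) = of_cterm s \<and> models \<sigma> (guard \<alpha>) \<and> ival \<sigma> (cost \<alpha>) = k \<and>
        image_mset of_cterm Q = image_mset (tval \<sigma>) (rhs \<alpha>) \<and>
        T = (S - {#s#}) + Q)"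

inductive steps :: "('f, 'v) program \<Rightarrow> 'f config \<Rightarrow> real \<Rightarrow> 'f config \<Rightarrow> bool"
  for P :: "('f, 'v) program" where
  steps_refl: "steps P S 0 S"
| steps_step: "step P S k T \<Longrightarrow> steps P T l U \<Longrightarrow> steps P S (k + l) U"

definition dh :: "('f, 'v) program \<Rightarrow> 'f config \<Rightarrow> ereal" where
  "dh P S = Sup {ereal k | k T. steps P S k T}"

text \<open>The third argument is the arity of the function symbols.\<close>

definition rc :: "('f, 'v) program \<Rightarrow> 'f \<Rightarrow> nat \<Rightarrow> nat \<Rightarrow> ereal" where
  "rc P f0 a n = Sup {dh P {#(f0, ns)#} | ns. length ns = a \<and> sum_list (map abs ns) \<le> int n}"

type_synonym ('f, 'v) processor = "('f, 'v) program \<rightharpoonup> ('f, 'v) program"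

definition is_processor :: "'f set \<Rightarrow> 'f \<Rightarrow> 'v list \<Rightarrow> ('f, 'v) processor \<Rightarrow> bool" where
  "is_processor F f0 xs proc \<longleftrightarrow>
     (\<forall>P P'. proc P = Some P' \<longrightarrow> integer_program F f0 xs P \<and> integer_program F f0 xs P')"

definition sound_processor :: "'f set \<Rightarrow> 'f \<Rightarrow> 'v list \<Rightarrow> ('f, 'v) processor \<Rightarrow> bool" where
  "sound_processor F f0 xs proc \<longleftrightarrow> is_processor F f0 xs proc \<and>
     (\<forall>P P' n. proc P = Some P' \<longrightarrow> rc P f0 (length xs) n \<ge> rc P' f0 (length xs) n)"


section \<open>Simple loops and metering functions\<close>

definition simple_loop :: "'v list \<Rightarrow> ('f, 'v) rule \<Rightarrow> 'v subst \<Rightarrow> bool" where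
  "simple_loop xs \<alpha> \<mu> \<longleftrightarrow> (\<exists>f. lhs \<alpha> = (f, map Var xs)) \<and>
     rhs \<alpha> = {#tsubst \<mu> (lhs \<alpha>)#} \<and> subst_dom \<mu> \<subseteq> set xs"

text \<open>Candidates for metering functions: plain expressions \<open>b\<close> and products \<open>\<chi>\<^sub>\<psi> \<cdot> b\<close>
  of an expression with the characteristic function of a constraint.\<close>

datatype 'v mexp = Plain "'v aexp" | Chi_Times "'v constr" "'v aexp"

definition chi :: "'v constr \<Rightarrow> 'v int_subst \<Rightarrow> real" where
  "chi \<psi> \<sigma> = (if models \<sigma> \<psi> then 1 else 0)"

primrec mvars :: "'v mexp \<Rightarrow> 'v set" where
  "mvars (Plain b) = avars b"
| "mvars (Chi_Times \<psi> b) = cvars \<psi> \<union> avars b"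

primrec msubst :: "'v subst \<Rightarrow> 'v mexp \<Rightarrow> 'v mexp" where
  "msubst \<sigma> (Plain b) = Plain (asubst \<sigma> b)"
| "msubst \<sigma> (Chi_Times \<psi> b) = Chi_Times (csubst \<sigma> \<psi>) (asubst \<sigma> b)"

primrec mval :: "'v int_subst \<Rightarrow> 'v mexp \<Rightarrow> real" where
  "mval \<sigma> (Plain b) = ival \<sigma> b"
| "mval \<sigma> (Chi_Times \<psi> b) = chi \<psi> \<sigma> * ival \<sigma> b"

definition metering_function :: "('f, 'v) rule \<Rightarrow> 'v subst \<Rightarrow> 'v mexp \<Rightarrow> bool" where
  "metering_function \<alpha> \<mu> m \<longleftrightarrow>
     valid (cvars (guard \<alpha>) \<union> mvars m)
       (\<lambda>\<sigma>. \<not> models \<sigma> (guard \<alpha>) \<longrightarrow> mval \<sigma> m \<le> 0) \<and>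
     valid (cvars (guard \<alpha>) \<union> mvars m \<union> mvars (msubst \<mu> m))
       (\<lambda>\<sigma>. models \<sigma> (guard \<alpha>) \<longrightarrow> mval \<sigma> (msubst \<mu> m) \<ge> mval \<sigma> m - 1)"

end

theory Submission
  imports Defs
begin

text \<open>
  A step with the accelerated rule under \<open>\<sigma>\<close> with \<open>\<sigma> tv = n\<close> is simulated by \<open>n\<close> steps with the
  loop. The guard of the accelerated rule gives \<open>\<chi>\<^sub>\<psi> \<cdot> b > n - 1\<close> at the start, and each iteration
  lowers this metering function by at most \<open>1\<close>; so it is positive before each of the \<open>n\<close>
  iterations, and a positive metering function forces the guard of the loop.

  Integer substitutions are totalised to \<open>total_subst v\<close> (with \<open>v = the \<circ> \<sigma>\<close>), because the accelerated
  rule need not mention all temporary variables of the loop.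
\<close>

section \<open>Total integer substitutions and substitution lemmas\<close>

definition total_subst :: "('v \<Rightarrow> int) \<Rightarrow> 'v int_subst" where
  "total_subst v = (\<lambda>x. Some (v x))"

lemma dom_total_subst [simp]: "dom (total_subst v) = UNIV"
  by (auto simp: total_subst_def)

lemma ival_total_subst: "ival (total_subst v) t = aeval (\<lambda>x. real_of_int (v x)) t"
  by (simp add: ival_def total_subst_def)

lemma asubst_subst_comp: "asubst (subst_comp \<theta> \<sigma>) t = asubst \<sigma> (asubst \<theta> t)"
  by (induction t) (auto simp: subst_comp_def)

lemma asubst_Var: "asubst Var t = t"
  by (induction t) auto

lemma ival_totalise: "ival (total_subst (the \<circ> \<sigma>)) t = ival \<sigma> t"
  by (simp add: ival_total_subst) (simp add: ival_def)

lemma holds_totalise: "holds (total_subst (the \<circ> \<sigma>)) i = holds \<sigma> i"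
  by (cases i) (simp_all add: ival_totalise)

text \<open>\<open>ival\<close> reads \<sigma> through \<open>the\<close>, so all values agree. Only
  this direction holds in general: totalising can also supply variables of \<open>\<phi>\<close>
  that \<sigma> leaves undefined.\<close>

lemma models_totalise: "models \<sigma> \<phi> \<Longrightarrow> models (total_subst (the \<circ> \<sigma>)) \<phi>"
  by (auto simp: models_def holds_totalise)

text \<open>Trades one application of \<mu> for a change of valuation from \<open>v\<close> to
  \<open>w\<close>. The assumption ensures that the state after an iteration is again given by
  integers.\<close>

lemma ival_asubst:
  assumes "\<And>x. ival (total_subst v) (\<mu> x) = real_of_int (w x)"
  shows "ival (total_subst v) (asubst \<mu> t) = ival (total_subst w) t"
  using assms by (induction t) (auto simp: ival_total_subst)

lemma holds_isubst:
  assumes "\<And>x. ival (total_subst v) (\<mu> x) = real_of_int (w x)"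
  shows "holds (total_subst v) (isubst \<mu> i) = holds (total_subst w) i"
  by (cases i) (simp_all add: ival_asubst[OF assms])

lemma mval_msubst:
  assumes "\<And>x. ival (total_subst v) (\<mu> x) = real_of_int (w x)"
  shows "mval (total_subst v) (msubst \<mu> m) = mval (total_subst w) m"
proof -
  have "models (total_subst v) (csubst \<mu> \<phi>) = models (total_subst w) \<phi>" for \<phi>
    by (auto simp: models_def csubst_def holds_isubst[OF assms])
  then show ?thesis
    by (cases m) (simp_all add: ival_asubst[OF assms] chi_def)
qed

section \<open>Metering functions and iteration of the loop\<close>

lemma metering_function_pos_models_guard:
  assumes "metering_function \<alpha> \<mu> m" and "mval (total_subst v) m > 0"
  shows "models (total_subst v) (guard \<alpha>)"
  using assms unfolding metering_function_def valid_def
  by (metis dom_total_subst linorder_not_le subset_UNIV)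

lemma metering_function_decrease:
  assumes "metering_function \<alpha> \<mu> m" and "models (total_subst v) (guard \<alpha>)"
  shows "mval (total_subst v) (msubst \<mu> m) \<ge> mval (total_subst v) m - 1"
  using assms unfolding metering_function_def valid_def by (metis dom_total_subst subset_UNIV)

text \<open>For program variables, \<open>\<mu> x\<close> is an argument of the right-hand side, so
  well-formedness applies; all other variables are fixed by \<mu>.\<close>

lemma simple_loop_update_integral:
  assumes "simple_loop xs \<alpha> \<mu>" and "well_formed_rule \<alpha>" and "models (total_subst v) (guard \<alpha>)"
  shows "\<exists>w. \<forall>x. ival (total_subst v) (\<mu> x) = real_of_int (w x)"
proof -
  have "ival (total_subst v) (\<mu> x) \<in> \<int>" for x
  proof (cases "x \<in> set xs")
    case True
    have "models_rule (total_subst v) \<alpha>"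
      using assms(3) by (simp add: models_rule_def)
    with assms(1,2) True show ?thesis
      by (force simp: well_formed_rule_def simple_loop_def tsubst_def)
  next
    case False
    then have "\<mu> x = Var x"
      using assms(1) by (auto simp: simple_loop_def subst_dom_def)
    then show ?thesis
      by (simp add: ival_total_subst)
  qed
  then have "ival (total_subst v) (\<mu> x) = real_of_int \<lfloor>ival (total_subst v) (\<mu> x)\<rfloor>" for x
    by (metis Ints_cases floor_of_int)
  then show ?thesis
    by (intro exI[of _ "\<lambda>x. \<lfloor>ival (total_subst v) (\<mu> x)\<rfloor>"] allI)
qed

lemma simple_loop_step:
  assumes "\<alpha> \<in> P" and "simple_loop xs \<alpha> \<mu>" and "lhs \<alpha> = (f, map Var xs)"
    and "models (total_subst v) (guard \<alpha>)"
    and w: "\<And>x. ival (total_subst v) (\<mu> x) = real_of_int (w x)"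
  shows "step P (S + {#(f, map v xs)#}) (ival (total_subst v) (cost \<alpha>)) (S + {#(f, map w xs)#})"
  unfolding step_def
proof (intro exI conjI)
  show "(f, map v xs) \<in># S + {#(f, map v xs)#}" by simp
  show "\<alpha> \<in> P" by fact
  show "rule_vars \<alpha> \<subseteq> dom (total_subst v)" by auto
  show "tval (total_subst v) (lhs \<alpha>) = of_cterm (f, map v xs)"
    by (simp add: assms(3) tval_def of_cterm_def ival_total_subst)
  show "models (total_subst v) (guard \<alpha>)" by fact
  show "image_mset of_cterm {#(f, map w xs)#} = image_mset (tval (total_subst v)) (rhs \<alpha>)"
    using assms(2) by (simp add: simple_loop_def assms(3) tval_def of_cterm_def tsubst_def w)
qed simp_all

text \<open>Induction on \<open>n\<close> for arbitrary \<open>v\<close>: the first iteration leads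
  from \<open>v\<close> to some \<open>u\<close>, where the metering function has dropped by at most
  1, and the remaining iterations start from \<open>u\<close>. The valuation includes the temporary
  variables, whose values are thus kept across all iterations.\<close>

lemma simple_loop_iterate:
  assumes "\<alpha> \<in> P" and "simple_loop xs \<alpha> \<mu>" and "lhs \<alpha> = (f, map Var xs)"
    and "well_formed_rule \<alpha>" and "metering_function \<alpha> \<mu> m"
    and "mval (total_subst v) m > real n - 1"
  shows "\<exists>w. (\<forall>x. ival (total_subst v) (subst_pow \<mu> n x) = real_of_int (w x)) \<and>
    steps P (S + {#(f, map v xs)#})
      (\<Sum>i<n. ival (total_subst v) (asubst (subst_pow \<mu> i) (cost \<alpha>))) (S + {#(f, map w xs)#})"
  using assms(6)
proof (induction n arbitrary: v)
  case 0
  show ?case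
    by (rule exI[of _ v]) (auto simp: ival_total_subst intro: steps_refl)
next
  case (Suc n)
  \<comment> \<open>For \<open>Suc n\<close> the premise bounds the metering function strictly below
    by \<open>real n\<close>, hence it is positive.\<close>
  have guard: "models (total_subst v) (guard \<alpha>)"
    using Suc.prems by (intro metering_function_pos_models_guard[OF assms(5)]) simp
  obtain u where u: "\<And>x. ival (total_subst v) (\<mu> x) = real_of_int (u x)"
    using simple_loop_update_integral[OF assms(2,4) guard] by blast
  have "mval (total_subst u) m > real n - 1"
    using metering_function_decrease[OF assms(5) guard] Suc.prems
    by (simp add: mval_msubst[OF u])
  from Suc.IH[OF this] obtain w where
    w: "\<And>x. ival (total_subst u) (subst_pow \<mu> n x) = real_of_int (w x)" and
    rest: "steps P (S + {#(f, map u xs)#})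
      (\<Sum>i<n. ival (total_subst u) (asubst (subst_pow \<mu> i) (cost \<alpha>))) (S + {#(f, map w xs)#})"
    by blast
  \<comment> \<open>In \<open>subst_pow \<mu> (Suc n)\<close> the extra \<mu> is applied last to the
    term, so evaluation at \<open>v\<close> becomes evaluation of the \<open>n\<close>-th power at
    \<open>u\<close>.\<close>
  have "ival (total_subst v) (subst_pow \<mu> (Suc n) x) = real_of_int (w x)" for x
    by (simp add: subst_comp_def ival_asubst[OF u] w)
  \<comment> \<open>The summand for \<open>i = 0\<close> is the cost of the first iteration;
    shifting the index turns the others into costs seen from \<open>u\<close>.\<close>
  moreover have "(\<Sum>i<Suc n. ival (total_subst v) (asubst (subst_pow \<mu> i) (cost \<alpha>))) =
      ival (total_subst v) (cost \<alpha>) + (\<Sum>i<n. ival (total_subst u) (asubst (subst_pow \<mu> i) (cost \<alpha>)))"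
    by (simp only: sum.lessThan_Suc_shift subst_pow.simps asubst_Var asubst_subst_comp
        ival_asubst[OF u])
  ultimately show ?case
    using steps_step[OF simple_loop_step[OF assms(1-3) guard u] rest] by auto
qed

section \<open>Simulation and runtime complexity\<close>

lemma inj_of_cterm: "inj of_cterm"
proof (rule injI)
  fix s t :: "'f \<times> int list" assume "of_cterm s = of_cterm t"
  moreover have "inj real_of_int" by (simp add: inj_def)
  ultimately show "s = t" by (simp add: of_cterm_def prod_eq_iff)
qed

lemma steps_trans: "steps P S k T \<Longrightarrow> steps P T l U \<Longrightarrow> steps P S (k + l) U"
  by (induction rule: steps.induct) (auto simp: add.assoc intro: steps_step)

lemma steps_simulate:
  assumes "\<And>S k T. step P' S k T \<Longrightarrow> \<exists>l\<ge>k. steps P S l T"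
  shows "steps P' S k T \<Longrightarrow> \<exists>l\<ge>k. steps P S l T"
proof (induction rule: steps.induct)
  case (steps_refl S)
  then show ?case by (auto intro: steps.steps_refl)
next
  case (steps_step S k T l U)
  then show ?case
    using assms[OF steps_step(1)] by (meson add_mono steps_trans)
qed

text \<open>Both \<open>dh\<close> and \<open>rc\<close> are suprema, so it suffices to reach the
  same configuration at a cost at least as high.\<close>

lemma rc_simulate:
  assumes "\<And>S k T. step P' S k T \<Longrightarrow> \<exists>l\<ge>k. steps P S l T"
  shows "rc P' f0 a n \<le> rc P f0 a n"
proof -
  have "dh P' S \<le> dh P S" for S
    unfolding dh_def
  proof (rule Sup_mono)
    fix x assume "x \<in> {ereal k |k T. steps P' S k T}"
    then obtain k T where x: "x = ereal k" and "steps P' S k T" by blast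
    with steps_simulate[OF assms] obtain l where "l \<ge> k" "steps P S l T" by blast
    with x show "\<exists>y\<in>{ereal k |k T. steps P S k T}. x \<le> y"
      by (intro bexI[of _ "ereal l"]) auto
  qed
  then show ?thesis
    unfolding rc_def by (intro Sup_mono) blast
qed

theorem theorem3p8:
  fixes F :: "'f set" and f0 :: 'f and xs :: "'v list"
    and P P' :: "('f, 'v) program" and \<alpha> \<alpha>_it :: "('f, 'v) rule"
    and \<mu> \<mu>_it :: "'v subst" and c c_it b :: "'v aexp" and \<psi> :: "'v constr" and tv :: 'v
  assumes "finite F" and "f0 \<in> F" and "distinct xs"
    and "integer_program F f0 xs P" and "well_formed P"
    and "\<alpha> \<in> P" and "simple_loop xs \<alpha> \<mu>" and "cost \<alpha> = c"
    and fresh: "tv \<notin> set xs" "tv \<notin> (\<Union>\<beta>\<in>P. rule_vars \<beta>)"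
    and metering: "metering_function \<alpha> \<mu> (Chi_Times \<psi> b)"
    and iterated_update: "\<And>n x. n > 0 \<Longrightarrow> x \<in> set xs \<Longrightarrow>
      valid ({tv} \<union> avars (\<mu>_it x) \<union> avars (subst_pow \<mu> n x))
        (\<lambda>\<sigma>. \<sigma> tv = Some (int n) \<longrightarrow> ival \<sigma> (\<mu>_it x) = ival \<sigma> (subst_pow \<mu> n x))"
    and iterated_cost: "\<And>n. n > 0 \<Longrightarrow>
      valid ({tv} \<union> avars c_it \<union> (\<Union>i<n. avars (asubst (subst_pow \<mu> i) c)))
        (\<lambda>\<sigma>. \<sigma> tv = Some (int n) \<longrightarrow>
             ival \<sigma> c_it \<le> (\<Sum>i<n. ival \<sigma> (asubst (subst_pow \<mu> i) c)))"
    and "\<alpha>_it = Rule (lhs \<alpha>) c_it {#tsubst \<mu>_it (lhs \<alpha>)#}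
           (guard \<alpha> @ \<psi> @ [Less (Const 0) (Var tv), Less (Var tv) (Add b (Const 1))])"
    and "P' = P \<union> {\<alpha>_it}"
  shows "well_formed P' \<and> sound_processor F f0 xs [P \<mapsto> P']"
proof -
  obtain f where lhs: "lhs \<alpha> = (f, map Var xs)"
    using assms(7) by (auto simp: simple_loop_def)
  have wf: "well_formed_rule \<alpha>"
    using assms(5,6) by (auto simp: well_formed_def)
  \<comment> \<open>Serves twice: the integer values \<open>w\<close> of the accelerated update give
    well-formedness of the new rule, and the derivation in \<open>P\<close> gives the
    simulation.\<close>
  have iterate: "\<exists>w k. map (ival \<sigma>) (map (asubst \<mu>_it) (map Var xs)) = map real_of_int (map w xs) \<and>
      ival \<sigma> c_it \<le> k \<and> steps P (S + {#(f, map (the \<circ> \<sigma>) xs)#}) k (S + {#(f, map w xs)#})"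
    if "models \<sigma> (guard \<alpha>_it)" for \<sigma> S
  proof -
    define v where "v = the \<circ> \<sigma>"
    define n where "n = nat (v tv)"
    have bounds: "0 < v tv" "real_of_int (v tv) < ival \<sigma> b + 1" and psi: "models \<sigma> \<psi>"
      using that by (auto simp: assms(14) models_def ival_def v_def cvars_def)
    then have n: "n > 0" "total_subst v tv = Some (int n)" "real n < ival \<sigma> b + 1"
      by (simp_all add: n_def total_subst_def)
    \<comment> \<open>\<psi> makes the characteristic function 1, and \<open>tv < b + 1\<close> is
      exactly the strict bound \<open>b > n - 1\<close>.\<close>
    have "mval (total_subst v) (Chi_Times \<psi> b) > real n - 1"
      using models_totalise[OF psi] n(3) by (simp add: chi_def v_def ival_totalise)
    from simple_loop_iterate[OF assms(6,7) lhs wf metering this] obtain w where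
      w: "\<And>x. ival (total_subst v) (subst_pow \<mu> n x) = real_of_int (w x)" and
      steps: "steps P (S + {#(f, map v xs)#})
        (\<Sum>i<n. ival (total_subst v) (asubst (subst_pow \<mu> i) c)) (S + {#(f, map w xs)#})"
      using assms(8) by blast
    have "ival \<sigma> (\<mu>_it x) = real_of_int (w x)" if "x \<in> set xs" for x
    proof -
      \<comment> \<open>The validity assumption also asks for the variables of
        \<open>subst_pow \<mu> n x\<close>, which \<sigma> may leave undefined; hence the instance
        at \<open>total_subst v\<close>.\<close>
      have "ival (total_subst v) (\<mu>_it x) = ival (total_subst v) (subst_pow \<mu> n x)"
        using iterated_update[OF n(1) that, unfolded valid_def, rule_format, of "total_subst v"] n(2)
        by auto
      then show ?thesis
        by (simp add: w) (simp add: v_def ival_totalise)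
    qed
    moreover have "ival (total_subst v) c_it \<le> (\<Sum>i<n. ival (total_subst v) (asubst (subst_pow \<mu> i) c))"
      using iterated_cost[OF n(1), unfolded valid_def, rule_format, of "total_subst v"] n(2)
      by auto
    ultimately show ?thesis
      using steps by (auto simp: v_def ival_totalise)
  qed
  have "well_formed_rule \<alpha>_it"
    unfolding well_formed_rule_def
  proof (intro allI impI)
    fix \<sigma> assume "models_rule \<sigma> \<alpha>_it"
    then obtain w where
      "map (ival \<sigma>) (map (asubst \<mu>_it) (map Var xs)) = map real_of_int (map w xs)"
      using iterate[of \<sigma> "{#}"] by (auto simp: models_rule_def)
    then show "\<forall>(f, ts)\<in>set_mset (rhs \<alpha>_it). \<forall>t\<in>set ts. ival \<sigma> t \<in> \<int>"
      by (auto simp: assms(14) lhs tsubst_def)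
  qed
  then have wf': "well_formed P'"
    using assms(5,15) by (auto simp: well_formed_def)
  have simulate: "\<exists>l\<ge>k. steps P S l T" if "step P' S k T" for S k T
  proof -
    from that obtain s \<beta> \<sigma> Q where step: "s \<in># S" "\<beta> \<in> P'" "rule_vars \<beta> \<subseteq> dom \<sigma>"
      "tval \<sigma> (lhs \<beta>) = of_cterm s" "models \<sigma> (guard \<beta>)" "ival \<sigma> (cost \<beta>) = k"
      "image_mset of_cterm Q = image_mset (tval \<sigma>) (rhs \<beta>)" "T = (S - {#s#}) + Q"
      unfolding step_def by blast
    show ?thesis
    proof (cases "\<beta> \<in> P")
      case True
      with step have "step P S k T"
        unfolding step_def by blast
      from steps_step[OF this steps_refl] show ?thesis by auto
    next
      case False
      with step(2) assms(15) have \<beta>: "\<beta> = \<alpha>_it" by simp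
      obtain w l where
        w: "map (ival \<sigma>) (map (asubst \<mu>_it) (map Var xs)) = map real_of_int (map w xs)" and
        l: "ival \<sigma> c_it \<le> l"
        "steps P ((S - {#s#}) + {#(f, map (the \<circ> \<sigma>) xs)#}) l ((S - {#s#}) + {#(f, map w xs)#})"
        using iterate[of \<sigma> "S - {#s#}"] step(5) \<beta> by blast
      \<comment> \<open>\<open>step\<close> compares terms only by their real values; injectivity of
        \<open>of_cterm\<close> recovers the integer terms, here for the redex and below for the
        multiset \<open>Q\<close>.\<close>
      have "of_cterm s = of_cterm (f, map (the \<circ> \<sigma>) xs)"
        unfolding step(4)[symmetric]
        by (simp add: \<beta> assms(14) lhs tval_def of_cterm_def ival_def)
      then have s: "s = (f, map (the \<circ> \<sigma>) xs)"
        by (rule injD[OF inj_of_cterm])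
      have "image_mset of_cterm Q = image_mset of_cterm {#(f, map w xs)#}"
        using step(7) w by (simp add: \<beta> assms(14) lhs tval_def of_cterm_def tsubst_def)
      then have "Q = {#(f, map w xs)#}"
        by (rule injD[OF multiset.inj_map[OF inj_of_cterm]])
      with l s step(1,6,8) show ?thesis
        by (auto simp: \<beta> assms(14))
    qed
  qed
  \<comment> \<open>\<alpha> itself has \<open>f\<close> on its right-hand side, so \<open>f\<close>
    cannot be the start symbol, and the new rule respects this condition too.\<close>
  have "f \<in> F" "f \<noteq> f0"
    using assms(4,6,7) lhs by (auto simp: integer_program_def simple_loop_def tsubst_def)
  then have "integer_program F f0 xs P'"
    using assms(4) lhs
    by (auto simp: integer_program_def assms(14,15) tsubst_def)
  moreover have "rc P' f0 (length xs) n \<le> rc P f0 (length xs) n" for n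
    using simulate by (rule rc_simulate)
  ultimately have "sound_processor F f0 xs [P \<mapsto> P']"
    using assms(4) unfolding sound_processor_def is_processor_def
    by (metis fun_upd_apply option.distinct(1) option.inject)
  with wf' show ?thesis ..
qed

end
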